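(* a) The set $\mathrm{Bip}_1(n)$ of one-line bipartitions of total degree $n$ is a coideal in $\mathrm{Bip}$ with respect to $\prec$; that is, if $\beta\in \mathrm{Bip}_1(n)$, $\beta'\in\mathrm{Bip}$ and $\beta\prec\beta'$, then $\beta'\in\mathrm{Bip}_1(n)$. b) The order $\prec$ on $\Lambda_n$ is a refinement of the quasi-hereditary order $<_{qh}$ on $\Lambda_n$, where $\lambda<_{qh}\mu$ iff $|\lambda|>|\mu|$.
   Context: $\mathrm{Bip}(n)$ is the set of bipartitions $(\lambda^{(1)},\lambda^{(2)})$ with $|\lambda^{(1)}|+|\lambda^{(2)}|=n$ and $\mathrm{Bip}=\bigcup_{n\ge0}\mathrm{Bip}(n)$. $\mathrm{Bip}_1(n)$ is the set of one-line bipartitions $((a),(b))$ with $a,b\ge0$, $a+b=n$ (where $(0)=\emptyset$). The 2-quotient $\mathcal Q$: for a partition $\lambda$ of $2N$ with empty 2-core choose $t$ such that $\lambda$ has at most $2t$ parts, write $\lambda=(\lambda_1\ge\dots\ge\lambda_{2t}\ge0)$, and let $X=\{\lambda_i+2t-i : 1\le i\le 2t\}$. As the 2-core is empty, $X$ contains exactly $t$ odd numbers $2x_1+1>\dots>2x_t+1$ and $t$ even numbers $2y_1>\dots>2y_t$. Put $\mathcal Q(\lambda)=(\lambda^{(1)},\lambda^{(2)})$ with $\lambda^{(1)}_i=x_i-(t-i)$ and $\lambda^{(2)}_i=y_i-(t-i)$. This is a bijection from partitions with empty 2-core to $\mathrm{Bip}$, mapping partitions of $2N$ to $\mathrm{Bip}(N)$;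 on one-line bipartitions, $\mathcal Q^{-1}((a),(b))=(2a,2b)$ if $a\ge b$ and $(2b-1,2a+1)$ if $a<b$. Partial order on $\mathrm{Bip}$: $\beta\prec\beta'$ iff $\mathcal Q^{-1}(\beta)\lhd\mathcal Q^{-1}(\beta')$, where $\lhd$ is the usual dominance order on partitions (comparing partitions of the same integer). $\Lambda_n=\{-n,-n+2,\dots,n-2,n\}$ is the parameterizing set for the quasi-hereditary category of modules over the blob algebra $b_n$, and the order $<_{qh}$ above is the quasi-hereditary order of that category. The map $f:\mathrm{Bip}_1(n)\to\Lambda_n$, $((a),(b))\mapsto a-b$, is a bijection. The order $\prec$ on $\Lambda_n$ is the one transported by $f$: $\lambda\prec\mu$ iff $f^{-1}(\lambda)\prec f^{-1}(\mu)$.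
   Formalization: In b) the orientation is corrected: the formal theorem says ≺ refines the reverse of <_qh, i.e. |λ|<|μ| implies λ≺μ. The literal claim fails for n=2: 2 <_qh 0, but f^{-1}(2), f^{-1}(0) correspond to (4), (2,2), and (2,2) ⊲ (4), so 0≺2. *)

theory Defs
  imports Main
begin

(* A partition is its 0-indexed sequence of parts, padded with zeros; the empty
   partition is the zero function, so the one-line partition (0) is empty. *)

type_synonym part = "nat \<Rightarrow> nat"

type_synonym bipart = "part \<times> part"

definition partitions :: "part set" where
  "partitions = {p. antimono p \<and> finite {i. p i \<noteq> 0}}"

definition psize :: "part \<Rightarrow> nat" where
  "psize p = (\<Sum>i | p i \<noteq> 0. p i)"

definition cells :: "part \<Rightarrow> (nat \<times> nat) set" where
  "cells p = {(i, j). j < p i}"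

definition dominated :: "part \<Rightarrow> part \<Rightarrow> bool"  (infix "\<lhd>" 50) where
  "p \<lhd> q \<longleftrightarrow> p \<in> partitions \<and> q \<in> partitions \<and> psize p = psize q \<and> p \<noteq> q \<and>
     (\<forall>k. (\<Sum>i<k. p i) \<le> (\<Sum>i<k. q i))"


definition remove_domino :: "part \<Rightarrow> part \<Rightarrow> bool" where
  "remove_domino p q \<longleftrightarrow> p \<in> partitions \<and> q \<in> partitions \<and> cells q \<subseteq> cells p \<and>
     (\<exists>i j. cells p - cells q = {(i, j), (i, Suc j)} \<or> cells p - cells q = {(i, j), (Suc i, j)})"

definition two_core_of :: "part \<Rightarrow> part \<Rightarrow> bool" where
  "two_core_of c p \<longleftrightarrow> remove_domino\<^sup>*\<^sup>* p c \<and> (\<nexists>q. remove_domino c q)"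

definition empty_core_partitions :: "part set" where
  "empty_core_partitions = {p \<in> partitions. two_core_of (\<lambda>_. 0) p}"


definition beta_set :: "nat \<Rightarrow> part \<Rightarrow> nat set" where
  "beta_set t p = {p i + (2 * t - Suc i) | i. i < 2 * t}"

(* For S = {s_1 > ... > s_t} the partition with parts s_i - (t - i), 1 \<le> i \<le> t. *)
definition part_of_set :: "nat set \<Rightarrow> part" where
  "part_of_set S = (\<lambda>i. if i < card S then rev (sorted_list_of_set S) ! i - (card S - Suc i) else 0)"

definition quotient_at :: "nat \<Rightarrow> part \<Rightarrow> bipart" where
  "quotient_at t p =
     (part_of_set {x. 2 * x + 1 \<in> beta_set t p}, part_of_set {y. 2 * y \<in> beta_set t p})"

(* p has at most 2 t parts iff p (2 t) = 0. On partitions with empty 2-core, the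
   result is the same for every such t. *)
definition two_quotient :: "part \<Rightarrow> bipart" where
  "two_quotient p = quotient_at (SOME t. p (2 * t) = 0) p"

definition two_quotient_inv :: "bipart \<Rightarrow> part" where
  "two_quotient_inv = inv_into empty_core_partitions two_quotient"


definition Bip_deg :: "nat \<Rightarrow> bipart set" where
  "Bip_deg n = {(p, q). p \<in> partitions \<and> q \<in> partitions \<and> psize p + psize q = n}"

definition Bip :: "bipart set" where
  "Bip = (\<Union>n. Bip_deg n)"

definition one_line :: "nat \<Rightarrow> part" where
  "one_line a = (\<lambda>_. 0)(0 := a)"

definition Bip1 :: "nat \<Rightarrow> bipart set" where
  "Bip1 n = {(one_line a, one_line b) | a b. a + b = n}"

definition bip_prec :: "bipart \<Rightarrow> bipart \<Rightarrow> bool"  (infix "\<prec>" 50) where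
  "\<beta> \<prec> \<beta>' \<longleftrightarrow> two_quotient_inv \<beta> \<lhd> two_quotient_inv \<beta>'"


definition Lam :: "nat \<Rightarrow> int set" where
  "Lam n = {- int n + 2 * int k | k. k \<le> n}"

definition wt :: "bipart \<Rightarrow> int" where
  "wt \<beta> = int (fst \<beta> 0) - int (snd \<beta> 0)"

definition lam_prec :: "nat \<Rightarrow> int \<Rightarrow> int \<Rightarrow> bool" where
  "lam_prec n l m \<longleftrightarrow> inv_into (Bip1 n) wt l \<prec> inv_into (Bip1 n) wt m"

definition qh_less :: "int \<Rightarrow> int \<Rightarrow> bool" where
  "qh_less l m \<longleftrightarrow> \<bar>l\<bar> > \<bar>m\<bar>"


definition coideal_in :: "'a set \<Rightarrow> ('a \<Rightarrow> 'a \<Rightarrow> bool) \<Rightarrow> 'a set \<Rightarrow> bool" where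
  "coideal_in A R C \<longleftrightarrow> C \<subseteq> A \<and> (\<forall>x\<in>C. \<forall>y\<in>A. R x y \<longrightarrow> y \<in> C)"

definition refines_on :: "'a set \<Rightarrow> ('a \<Rightarrow> 'a \<Rightarrow> bool) \<Rightarrow> ('a \<Rightarrow> 'a \<Rightarrow> bool) \<Rightarrow> bool" where
  "refines_on A R S \<longleftrightarrow> (\<forall>x\<in>A. \<forall>y\<in>A. S x y \<longrightarrow> R x y)"

(* Orientation: the weights of large absolute value are small for qh_less, but
   correspond to the dominant partitions and hence are large for lam_prec: for
   n = 2, qh_less 2 0, whereas (2,2) \<lhd> (4) gives lam_prec 2 0 2. The two orders
   follow opposite conventions, so it is the converse of qh_less that lam_prec refines. *)

end

theory Submission
  imports Defs
begin

text \<open>Colour the cells of a partition like a checkerboard. Removing a domino preserves the difference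
  of the colour counts, and a domino-free partition is a staircase, which has difference 0 only if
  it is empty. So the partitions with empty 2-core are those with difference 0, which means exactly
  that the beta set has equally many odd and even elements; hence the 2-quotient is a bijection onto
  bipartitions. One-line bipartitions of degree \<open>n\<close> correspond to partitions of \<open>2 * n\<close> with at
  most two rows, and such partitions are closed upwards in the dominance order and totally ordered
  by their first row, which is \<open>n + \<bar>a - b\<bar>\<close> or \<open>n + \<bar>a - b\<bar> - 1\<close>.\<close>

section \<open>Partitions\<close>

lemma partitions_eventually_zero:
  assumes "p \<in> partitions"
  obtains n where "\<And>i. n \<le> i \<Longrightarrow> p i = 0"
proof -
  have "finite {i. p i \<noteq> 0}"
    using assms by (simp add: partitions_def)
  then obtain n where "\<forall>i\<in>{i. p i \<noteq> 0}. i < n"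
    using finite_nat_set_iff_bounded by blast
  then show thesis
    using that[of n] by force
qed

lemma partitionsI:
  assumes "\<And>i. p (Suc i) \<le> p i" and "p n = 0"
  shows "p \<in> partitions"
proof -
  have am: "antimono p"
    using assms(1) by (simp add: antimono_iff_le_Suc)
  have "{i. p i \<noteq> 0} \<subseteq> {..<n}"
  proof
    fix i assume "i \<in> {i. p i \<noteq> 0}"
    then show "i \<in> {..<n}"
      using antimonoD[OF am, of n i] assms(2) by (cases "n \<le> i") auto
  qed
  then show ?thesis
    using am finite_subset by (auto simp: partitions_def)
qed

lemma partitions_antimono:
  "p \<in> partitions \<Longrightarrow> i \<le> j \<Longrightarrow> p j \<le> p i"
  by (auto simp: partitions_def antimono_def)

lemma partitions_zero:
  "p \<in> partitions \<Longrightarrow> p n = 0 \<Longrightarrow> n \<le> i \<Longrightarrow> p i = 0"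
  using partitions_antimono[of p n i] by simp

lemma psize_eq_sum:
  assumes "\<And>i. n \<le> i \<Longrightarrow> p i = 0"
  shows "psize p = (\<Sum>i<n. p i)"
proof -
  have "{i. p i \<noteq> 0} \<subseteq> {..<n}"
    using assms by (force simp: not_less[symmetric])
  then show ?thesis
    unfolding psize_def by (intro sum.mono_neutral_left) auto
qed

section \<open>Beta numbers\<close>

definition betas :: "nat \<Rightarrow> part \<Rightarrow> nat set" where
  "betas n p = (\<lambda>i. p i + (n - Suc i)) ` {..<n}"

lemma beta_set_eq_betas: "beta_set t p = betas (2 * t) p"
  unfolding beta_set_def betas_def by blast

lemma beta_strict_decreasing:
  assumes "p \<in> partitions" "i < j" "j < n"
  shows "p j + (n - Suc j) < p i + (n - Suc i)"
  using partitions_antimono[of p i j] assms by linarith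

lemma inj_on_beta:
  assumes "p \<in> partitions"
  shows "inj_on (\<lambda>i. p i + (n - Suc i)) {..<n}"
proof (rule inj_onI)
  fix i j
  assume "i \<in> {..<n}" "j \<in> {..<n}" "p i + (n - Suc i) = p j + (n - Suc j)"
  then show "i = j"
    using beta_strict_decreasing[OF assms, of i j n] beta_strict_decreasing[OF assms, of j i n]
    by (cases i j rule: linorder_cases) auto
qed

lemma finite_betas [simp]: "finite (betas n p)"
  by (simp add: betas_def)

lemma card_betas: "p \<in> partitions \<Longrightarrow> card (betas n p) = n"
  unfolding betas_def using card_image[OF inj_on_beta] by simp

lemma rev_sorted_list_of_betas:
  assumes "p \<in> partitions"
  shows "rev (sorted_list_of_set (betas n p)) = map (\<lambda>i. p i + (n - Suc i)) [0..<n]"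
proof -
  let ?xs = "rev (map (\<lambda>i. p i + (n - Suc i)) [0..<n])"
  have "sorted_wrt (\<lambda>x y. y \<le> x) (map (\<lambda>i. p i + (n - Suc i)) [0..<n])"
    unfolding sorted_wrt_iff_nth_less
    using beta_strict_decreasing[OF assms, of _ _ n] by (auto intro: less_imp_le)
  then have "sorted ?xs"
    by (simp add: sorted_wrt_rev)
  moreover have "distinct ?xs"
    using inj_on_beta[OF assms, of n] by (simp add: distinct_map atLeast0LessThan)
  moreover have "set ?xs = betas n p"
    by (auto simp: betas_def)
  ultimately have "sorted_list_of_set (betas n p) = ?xs"
    by (metis sorted_list_of_set.idem_if_sorted_distinct)
  then show ?thesis
    by simp
qed

lemma part_of_set_betas:
  assumes "p \<in> partitions" "p n = 0"
  shows "part_of_set (betas n p) = p"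
proof
  fix i
  show "part_of_set (betas n p) i = p i"
    using partitions_zero[OF assms, of i]
    by (auto simp: part_of_set_def card_betas[OF assms(1)] rev_sorted_list_of_betas[OF assms(1)])
qed

lemma strict_sorted_nth_ge:
  fixes xs :: "nat list"
  assumes "sorted_wrt (<) xs" "k < length xs"
  shows "k \<le> xs ! k"
  using assms(2)
proof (induction k)
  case (Suc k)
  then show ?case
    using sorted_wrt_nth_less[OF assms(1), of k "Suc k"] by simp
qed simp

lemma rev_sorted_list_of_set_nth:
  assumes "i < card S"
  shows "rev (sorted_list_of_set S) ! i = part_of_set S i + (card S - Suc i)"
proof -
  have "rev (sorted_list_of_set S) ! i = sorted_list_of_set S ! (card S - Suc i)"
    using assms by (simp add: rev_nth)
  moreover have "card S - Suc i \<le> sorted_list_of_set S ! (card S - Suc i)"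
    using assms by (intro strict_sorted_nth_ge) auto
  ultimately show ?thesis
    using assms by (simp add: part_of_set_def)
qed

lemma part_of_set_card [simp]: "part_of_set S (card S) = 0"
  by (simp add: part_of_set_def)

lemma part_of_set_partitions: "part_of_set S \<in> partitions"
proof (rule partitionsI[where n = "card S"])
  fix i
  show "part_of_set S (Suc i) \<le> part_of_set S i"
  proof (cases "Suc i < card S")
    case True
    have "sorted_list_of_set S ! (card S - Suc (Suc i)) < sorted_list_of_set S ! (card S - Suc i)"
      using True by (intro sorted_wrt_nth_less[of "(<)"]) auto
    then have "rev (sorted_list_of_set S) ! Suc i < rev (sorted_list_of_set S) ! i"
      using True by (simp add: rev_nth)
    then show ?thesis
      using True rev_sorted_list_of_set_nth[of i S] rev_sorted_list_of_set_nth[of "Suc i" S] by simp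
  next
    case False
    then show ?thesis
      by (simp add: part_of_set_def)
  qed
qed simp

lemma betas_part_of_set:
  assumes "finite S"
  shows "betas (card S) (part_of_set S) = S"
proof -
  have "betas (card S) (part_of_set S) = (\<lambda>i. rev (sorted_list_of_set S) ! i) ` {..<card S}"
    unfolding betas_def by (intro image_cong) (auto simp: rev_sorted_list_of_set_nth)
  also have "\<dots> = set (rev (sorted_list_of_set S))"
    by (auto simp: set_conv_nth image_def)
  finally show ?thesis
    using assms by simp
qed

lemma betas_Suc:
  assumes "p n = 0"
  shows "betas (Suc n) p = insert 0 (Suc ` betas n p)"
proof -
  have "Suc ` betas n p = (\<lambda>i. p i + (Suc n - Suc i)) ` {..<n}"
    unfolding betas_def image_image by (intro image_cong) auto
  then show ?thesis
    using assms by (simp add: betas_def lessThan_Suc)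
qed

lemma part_of_set_shift:
  assumes "finite S"
  shows "part_of_set (insert 0 (Suc ` S)) = part_of_set S"
proof -
  have "insert 0 (Suc ` S) = betas (Suc (card S)) (part_of_set S)"
    using betas_Suc[of "part_of_set S" "card S"] betas_part_of_set[OF assms] by simp
  moreover have "part_of_set S (Suc (card S)) = 0"
    by (simp add: part_of_set_def)
  ultimately show ?thesis
    using part_of_set_betas[OF part_of_set_partitions] by simp
qed

definition odd_half :: "nat set \<Rightarrow> nat set" where
  "odd_half X = {x. 2 * x + 1 \<in> X}"

definition even_half :: "nat set \<Rightarrow> nat set" where
  "even_half X = {y. 2 * y \<in> X}"

lemma halves_decompose:
  "X = (\<lambda>x. 2 * x + 1) ` odd_half X \<union> (\<lambda>y. 2 * y) ` even_half X"
proof (rule set_eqI)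
  fix z
  show "z \<in> X \<longleftrightarrow> z \<in> (\<lambda>x. 2 * x + 1) ` odd_half X \<union> (\<lambda>y. 2 * y) ` even_half X"
    by (cases "even z") (auto simp: odd_half_def even_half_def elim!: evenE oddE)
qed

lemma halves_of_union:
  "odd_half ((\<lambda>x. 2 * x + 1) ` A \<union> (\<lambda>y. 2 * y) ` B) = A"
  "even_half ((\<lambda>x. 2 * x + 1) ` A \<union> (\<lambda>y. 2 * y) ` B) = B"
  unfolding odd_half_def even_half_def image_iff by (auto; presburger)+

lemma finite_halves:
  assumes "finite X"
  shows "finite (odd_half X)" "finite (even_half X)"
proof -
  have "(\<lambda>x. 2 * x + 1) ` odd_half X \<subseteq> X" "(\<lambda>y. 2 * y) ` even_half X \<subseteq> X"
    by (auto simp: odd_half_def even_half_def)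
  then have "finite ((\<lambda>x. 2 * x + 1) ` odd_half X)" "finite ((\<lambda>y. 2 * y) ` even_half X)"
    using assms finite_subset by blast+
  then show "finite (odd_half X)" "finite (even_half X)"
    by (simp_all add: finite_image_iff inj_on_def)
qed

lemma quotient_at_eq:
  "quotient_at t p = (part_of_set (odd_half (betas (2 * t) p)), part_of_set (even_half (betas (2 * t) p)))"
  by (simp add: quotient_at_def odd_half_def even_half_def beta_set_eq_betas)

lemma quotient_at_Suc:
  assumes "p \<in> partitions" "p (2 * t) = 0"
  shows "quotient_at (Suc t) p = quotient_at t p"
proof -
  let ?X = "betas (2 * t) p"
  have "p (Suc (2 * t)) = 0"
    using partitions_zero[OF assms] by simp
  then have eq: "betas (2 * Suc t) p = insert 0 (insert 1 (Suc ` Suc ` ?X))"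
    using assms(2) by (simp add: betas_Suc)
  have "odd_half (betas (2 * Suc t) p) = insert 0 (Suc ` odd_half ?X)"
  proof (rule set_eqI)
    show "x \<in> odd_half (betas (2 * Suc t) p) \<longleftrightarrow> x \<in> insert 0 (Suc ` odd_half ?X)" for x
      unfolding eq by (cases x) (auto simp: odd_half_def)
  qed
  moreover have "even_half (betas (2 * Suc t) p) = insert 0 (Suc ` even_half ?X)"
  proof (rule set_eqI)
    show "x \<in> even_half (betas (2 * Suc t) p) \<longleftrightarrow> x \<in> insert 0 (Suc ` even_half ?X)" for x
      unfolding eq by (cases x) (auto simp: even_half_def)
  qed
  ultimately show ?thesis
    by (simp add: quotient_at_eq part_of_set_shift finite_halves)
qed

lemma quotient_at_mono:
  assumes "p \<in> partitions" "p (2 * t) = 0" "t \<le> s"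
  shows "quotient_at s p = quotient_at t p"
  using assms(3)
proof (induction s rule: dec_induct)
  case (step m)
  then show ?case
    using quotient_at_Suc[OF assms(1), of m] partitions_zero[OF assms(1,2), of "2 * m"] by simp
qed simp

lemma two_quotient_eq:
  assumes "p \<in> partitions" "p (2 * t) = 0"
  shows "two_quotient p = quotient_at t p"
proof -
  let ?s = "SOME t. p (2 * t) = 0"
  have "p (2 * ?s) = 0"
    using assms(2) by (rule someI)
  then show ?thesis
    unfolding two_quotient_def
    using quotient_at_mono[OF assms(1)] assms(2) by (metis nat_le_linear)
qed

section \<open>The 2-core and the checkerboard charge\<close>

definition charge :: "part \<Rightarrow> int" where
  "charge p = (\<Sum>(i, j)\<in>cells p. (-1) ^ (i + j))"

lemma cells_eq_Sigma:
  assumes "p \<in> partitions" "p n = 0"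
  shows "cells p = Sigma {..<n} (\<lambda>i. {..<p i})"
proof -
  have "i < n" if "j < p i" for i j
    using partitions_zero[OF assms, of i] that by (cases "n \<le> i") auto
  then show ?thesis
    by (auto simp: cells_def)
qed

lemma finite_cells: "p \<in> partitions \<Longrightarrow> finite (cells p)"
  using cells_eq_Sigma partitions_eventually_zero[of p] by (metis finite_SigmaI finite_lessThan order_refl)

lemma alternating_sum: "(\<Sum>j<m. (-1 :: int) ^ j) = (if odd m then 1 else 0)"
  by (induction m) auto

lemma charge_eq_sum:
  assumes "p \<in> partitions" "p n = 0"
  shows "charge p = (\<Sum>i<n. if odd (p i) then (-1) ^ i else 0)"
proof -
  have "charge p = (\<Sum>i<n. \<Sum>j<p i. (-1) ^ (i + j))"
    unfolding charge_def cells_eq_Sigma[OF assms] by (subst sum.Sigma) auto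
  also have "\<dots> = (\<Sum>i<n. (-1) ^ i * (\<Sum>j<p i. (-1) ^ j))"
    by (simp add: power_add sum_distrib_left)
  also have "\<dots> = (\<Sum>i<n. if odd (p i) then (-1) ^ i else 0)"
    by (intro sum.cong) (auto simp: alternating_sum)
  finally show ?thesis .
qed

lemma charge_remove_domino:
  assumes "remove_domino p q"
  shows "charge p = charge q"
proof -
  have p: "p \<in> partitions" and sub: "cells q \<subseteq> cells p"
    and ex: "\<exists>i j. cells p - cells q = {(i, j), (i, Suc j)} \<or> cells p - cells q = {(i, j), (Suc i, j)}"
    using assms by (auto simp: remove_domino_def)
  have "(\<Sum>(i, j)\<in>cells p - cells q. (-1 :: int) ^ (i + j)) = 0"
    using ex by auto
  then show ?thesis
    using sum.subset_diff[OF sub finite_cells[OF p], of "\<lambda>(i, j). (-1 :: int) ^ (i + j)"]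
    by (simp add: charge_def)
qed

lemma charge_remove_dominoes: "remove_domino\<^sup>*\<^sup>* p q \<Longrightarrow> charge p = charge q"
  by (induction rule: rtranclp_induct) (auto simp: charge_remove_domino)

lemma horizontal_domino:
  assumes "p \<in> partitions" "p (Suc i) + 2 \<le> p i"
  shows "\<exists>q. remove_domino p q"
proof -
  let ?q = "p(i := p i - 2)"
  obtain n where n: "\<And>j. n \<le> j \<Longrightarrow> p j = 0"
    using partitions_eventually_zero[OF assms(1)] by blast
  have "?q \<in> partitions"
  proof (rule partitionsI[where n = n])
    show "?q (Suc j) \<le> ?q j" for j
      using assms partitions_antimono[OF assms(1), of j "Suc j"] by auto
  qed (simp add: n)
  moreover have "cells ?q \<subseteq> cells p"
    by (auto simp: cells_def split: if_splits)
  moreover have "cells p - cells ?q = {(i, p i - 2), (i, Suc (p i - 2))}"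
    using assms(2) by (auto simp: cells_def split: if_splits)
  ultimately show ?thesis
    using assms(1) unfolding remove_domino_def by blast
qed

lemma vertical_domino:
  assumes "p \<in> partitions" "p (Suc i) = p i" "p (Suc (Suc i)) < p i"
  shows "\<exists>q. remove_domino p q"
proof -
  let ?q = "p(i := p i - 1, Suc i := p i - 1)"
  obtain n where n: "\<And>j. n \<le> j \<Longrightarrow> p j = 0"
    using partitions_eventually_zero[OF assms(1)] by blast
  have "?q \<in> partitions"
  proof (rule partitionsI[where n = n])
    show "?q (Suc j) \<le> ?q j" for j
      using assms partitions_antimono[OF assms(1), of j "Suc j"] by auto
    show "?q n = 0"
      using n[of n] assms(2) by auto
  qed
  moreover have "cells ?q \<subseteq> cells p"
    using assms(2) by (auto simp: cells_def split: if_splits)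
  moreover have "cells p - cells ?q = {(i, p i - 1), (Suc i, p i - 1)}"
    using assms(2,3) by (auto simp: cells_def split: if_splits)
  ultimately show ?thesis
    using assms(1) unfolding remove_domino_def by blast
qed

lemma domino_free_step:
  assumes p: "p \<in> partitions" and free: "\<nexists>q. remove_domino p q" and pos: "p i > 0"
  shows "p i = Suc (p (Suc i))"
proof -
  have "p (Suc i) \<noteq> p i"
  proof
    assume eq: "p (Suc i) = p i"
    have const: "p (i + k) = p i \<and> p (Suc (i + k)) = p i" for k
    proof (induction k)
      case (Suc k)
      have "\<not> p (Suc (Suc (i + k))) < p (i + k)"
        using vertical_domino[OF p, of "i + k"] free Suc by auto
      then show ?case
        using partitions_antimono[OF p, of "i + k" "Suc (Suc (i + k))"] Suc by simp
    qed (simp add: eq)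
    obtain n where "\<And>j. n \<le> j \<Longrightarrow> p j = 0"
      using partitions_eventually_zero[OF p] by blast
    then have "p (i + n) = 0"
      by simp
    then show False
      using const[of n] pos by simp
  qed
  then show ?thesis
    using horizontal_domino[OF p, of i] free partitions_antimono[OF p, of i "Suc i"] by force
qed

lemma domino_free_staircase:
  assumes "p \<in> partitions" "\<nexists>q. remove_domino p q"
  shows "p i = p 0 - i"
proof (induction i)
  case (Suc i)
  show ?case
  proof (cases "p i = 0")
    case True
    then show ?thesis
      using Suc partitions_antimono[OF assms(1), of i "Suc i"] by simp
  next
    case False
    then show ?thesis
      using Suc domino_free_step[OF assms, of i] by simp
  qed
qed simp

text \<open>In a staircase, the rows of odd length all start on the same colour.\<close>

lemma domino_free_charge:
  assumes "p \<in> partitions" "\<nexists>q. remove_domino p q" "charge p = 0"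
  shows "p = (\<lambda>_. 0)"
proof -
  define h where "h = p 0"
  have st: "p i = h - i" for i
    unfolding h_def by (rule domino_free_staircase[OF assms(1,2)])
  have "charge p = (\<Sum>i<h. if odd (p i) then (-1) ^ i else 0)"
    by (rule charge_eq_sum[OF assms(1)]) (simp add: st)
  also have "\<dots> = (\<Sum>i<h. (-1) ^ Suc h * (if odd (p i) then 1 else 0))"
    by (intro sum.cong) (auto simp: st minus_one_power_iff)
  also have "\<dots> = (-1) ^ Suc h * int (card {i \<in> {..<h}. odd (p i)})"
    by (simp only: sum_distrib_left[symmetric]) (simp add: sum.If_cases Int_def)
  finally have empty: "{i \<in> {..<h}. odd (p i)} = {}"
    using assms(3) by simp
  have "h = 0"
  proof (rule ccontr)
    assume "h \<noteq> 0"
    then have "h - 1 \<in> {i \<in> {..<h}. odd (p i)}"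
      by (simp add: st)
    then show False
      using empty by blast
  qed
  then show ?thesis
    using st by auto
qed

lemma remove_domino_card:
  assumes "remove_domino p q"
  shows "card (cells q) < card (cells p)"
  using assms by (intro psubset_card_mono) (auto simp: remove_domino_def finite_cells)

lemma zero_domino_free: "\<not> remove_domino (\<lambda>_. 0) q"
  using remove_domino_card[of "\<lambda>_. 0" q] by (auto simp: cells_def)

lemma remove_dominoes_to_zero:
  assumes "p \<in> partitions" "charge p = 0"
  shows "remove_domino\<^sup>*\<^sup>* p (\<lambda>_. 0)"
  using assms
proof (induction "card (cells p)" arbitrary: p rule: less_induct)
  case less
  show ?case
  proof (cases "\<exists>q. remove_domino p q")
    case True
    then obtain q where q: "remove_domino p q"
      by blast
    then have "remove_domino\<^sup>*\<^sup>* q (\<lambda>_. 0)"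
      using less remove_domino_card[OF q] charge_remove_domino[OF q]
      by (auto simp: remove_domino_def)
    then show ?thesis
      using q by (metis converse_rtranclp_into_rtranclp)
  next
    case False
    then show ?thesis
      using domino_free_charge[OF less(2) _ less(3)] by simp
  qed
qed

lemma empty_core_iff_charge:
  "p \<in> empty_core_partitions \<longleftrightarrow> p \<in> partitions \<and> charge p = 0"
proof -
  have "charge (\<lambda>_. 0) = 0"
    by (simp add: charge_def cells_def)
  then show ?thesis
    using charge_remove_dominoes remove_dominoes_to_zero zero_domino_free
    by (fastforce simp: empty_core_partitions_def two_core_of_def)
qed

lemma sum_signs_halves:
  assumes "finite X"
  shows "(\<Sum>x\<in>X. (-1 :: int) ^ x) = int (card (even_half X)) - int (card (odd_half X))"
    and "card X = card (even_half X) + card (odd_half X)"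
proof -
  let ?O = "(\<lambda>x. 2 * x + 1) ` odd_half X" and ?E = "(\<lambda>y. 2 * y) ` even_half X"
  have fin: "finite ?O" "finite ?E"
    using finite_halves[OF assms] by auto
  have disj: "?O \<inter> ?E = {}"
    by (auto, presburger)
  have inj: "inj_on (\<lambda>x. 2 * x + 1) (odd_half X)" "inj_on (\<lambda>y. 2 * y) (even_half X)"
    by (auto intro: inj_onI)
  show "(\<Sum>x\<in>X. (-1 :: int) ^ x) = int (card (even_half X)) - int (card (odd_half X))"
    by (subst halves_decompose[of X], subst sum.union_disjoint[OF fin disj])
      (simp add: sum.reindex[OF inj(1), unfolded o_def, simplified] sum.reindex[OF inj(2), unfolded o_def])
  show "card X = card (even_half X) + card (odd_half X)"
    by (subst halves_decompose[of X], subst card_Un_disjoint[OF fin disj])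
      (simp add: card_image[OF inj(1), simplified] card_image[OF inj(2)])
qed

text \<open>The beta number of row \<open>i\<close> has the parity of \<open>p i + i + 1\<close>, so an even row contributes
  \<open>-(-1) ^ i\<close> to the sum of signs and an odd row \<open>(-1) ^ i\<close>; the constant part cancels over an even
  number of rows.\<close>

lemma sum_signs_betas:
  assumes "p \<in> partitions" "p (2 * t) = 0"
  shows "(\<Sum>x\<in>betas (2 * t) p. (-1 :: int) ^ x) = 2 * charge p"
proof -
  have "(\<Sum>x\<in>betas (2 * t) p. (-1 :: int) ^ x) = (\<Sum>i<2 * t. (-1) ^ (p i + (2 * t - Suc i)))"
    unfolding betas_def by (subst sum.reindex[OF inj_on_beta[OF assms(1)]]) simp
  also have "\<dots> = (\<Sum>i<2 * t. 2 * (if odd (p i) then (-1) ^ i else 0) - (-1) ^ i)"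
    by (intro sum.cong) (auto simp: minus_one_power_iff)
  also have "\<dots> = 2 * charge p"
    by (simp add: sum_subtractf sum_distrib_left[symmetric] charge_eq_sum[OF assms] alternating_sum)
  finally show ?thesis .
qed

lemma charge_zero_iff_balanced:
  assumes "p \<in> partitions" "p (2 * t) = 0"
  shows "charge p = 0 \<longleftrightarrow>
    card (odd_half (betas (2 * t) p)) = t \<and> card (even_half (betas (2 * t) p)) = t"
  using sum_signs_halves[of "betas (2 * t) p"] sum_signs_betas[OF assms] card_betas[OF assms(1), of "2 * t"]
  by auto

section \<open>The 2-quotient is a bijection\<close>

lemma two_quotient_inj: "inj_on two_quotient empty_core_partitions"
proof (rule inj_onI)
  fix p q
  assume p: "p \<in> empty_core_partitions" and q: "q \<in> empty_core_partitions"
    and eq: "two_quotient p = two_quotient q"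
  have pp: "p \<in> partitions" "charge p = 0" and qp: "q \<in> partitions" "charge q = 0"
    using p q by (auto simp: empty_core_iff_charge)
  obtain m n where "\<And>i. m \<le> i \<Longrightarrow> p i = 0" "\<And>i. n \<le> i \<Longrightarrow> q i = 0"
    using partitions_eventually_zero[OF pp(1)] partitions_eventually_zero[OF qp(1)] by metis
  then obtain t where t: "p (2 * t) = 0" "q (2 * t) = 0"
    using that[of "m + n"] by simp
  let ?X = "betas (2 * t) p" and ?Y = "betas (2 * t) q"
  have "quotient_at t p = quotient_at t q"
    using eq two_quotient_eq[OF pp(1) t(1)] two_quotient_eq[OF qp(1) t(2)] by simp
  then have "part_of_set (odd_half ?X) = part_of_set (odd_half ?Y)"
    "part_of_set (even_half ?X) = part_of_set (even_half ?Y)"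
    by (auto simp: quotient_at_eq)
  moreover have "card (odd_half ?X) = t" "card (even_half ?X) = t"
    "card (odd_half ?Y) = t" "card (even_half ?Y) = t"
    using charge_zero_iff_balanced[OF pp(1) t(1)] charge_zero_iff_balanced[OF qp(1) t(2)] pp qp by auto
  ultimately have "odd_half ?X = odd_half ?Y" "even_half ?X = even_half ?Y"
    using betas_part_of_set finite_halves finite_betas by metis+
  then have "?X = ?Y"
    using halves_decompose[of ?X] halves_decompose[of ?Y] by metis
  then show "p = q"
    using part_of_set_betas[OF pp(1) t(1)] part_of_set_betas[OF qp(1) t(2)] by metis
qed

lemma two_quotient_surj:
  assumes "p \<in> partitions" "q \<in> partitions"
  shows "\<exists>r\<in>empty_core_partitions. two_quotient r = (p, q)"
proof -
  obtain m n where "\<And>i. m \<le> i \<Longrightarrow> p i = 0" "\<And>i. n \<le> i \<Longrightarrow> q i = 0"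
    using partitions_eventually_zero[OF assms(1)] partitions_eventually_zero[OF assms(2)] by metis
  then obtain t where t: "p t = 0" "q t = 0"
    using that[of "m + n"] by simp
  define X where "X = (\<lambda>x. 2 * x + 1) ` betas t p \<union> (\<lambda>y. 2 * y) ` betas t q"
  define r where "r = part_of_set X"
  have halves: "odd_half X = betas t p" "even_half X = betas t q"
    unfolding X_def by (rule halves_of_union)+
  have fin: "finite X"
    by (simp add: X_def)
  have card: "card X = 2 * t"
    using sum_signs_halves(2)[OF fin] by (simp add: halves card_betas assms)
  have rp: "r \<in> partitions" and rt: "r (2 * t) = 0"
    by (auto simp: r_def part_of_set_partitions card[symmetric])
  have X: "betas (2 * t) r = X"
    using betas_part_of_set[OF fin] by (simp add: r_def card)
  have "charge r = 0"
    using charge_zero_iff_balanced[OF rp rt] by (simp add: X halves card_betas assms)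
  moreover have "two_quotient r = (p, q)"
    using two_quotient_eq[OF rp rt] assms t by (simp add: quotient_at_eq X halves part_of_set_betas)
  ultimately show ?thesis
    using rp by (auto simp: empty_core_iff_charge)
qed

lemma two_quotient_inv_props:
  assumes "\<beta> \<in> Bip"
  shows "two_quotient_inv \<beta> \<in> empty_core_partitions" "two_quotient (two_quotient_inv \<beta>) = \<beta>"
proof -
  obtain p q where "\<beta> = (p, q)" "p \<in> partitions" "q \<in> partitions"
    using assms by (auto simp: Bip_def Bip_deg_def)
  then have "\<beta> \<in> two_quotient ` empty_core_partitions"
    using two_quotient_surj by force
  then show "two_quotient_inv \<beta> \<in> empty_core_partitions" "two_quotient (two_quotient_inv \<beta>) = \<beta>"
    unfolding two_quotient_inv_def by (simp_all add: inv_into_into f_inv_into_f)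
qed

section \<open>Partitions with at most two rows\<close>

definition two_row :: "nat \<Rightarrow> nat \<Rightarrow> part" where
  "two_row u v = (\<lambda>_. 0)(0 := u, 1 := v)"

lemma two_row_simps [simp]:
  "two_row u v 0 = u" "two_row u v (Suc 0) = v" "2 \<le> i \<Longrightarrow> two_row u v i = 0"
  by (auto simp: two_row_def)

lemma two_row_partitions: "v \<le> u \<Longrightarrow> two_row u v \<in> partitions"
  by (rule partitionsI[where n = 2]) (auto simp: two_row_def)

lemma sum_two_row: "(\<Sum>i<k. two_row u v i) = (if k = 0 then 0 else if k = 1 then u else u + v)"
proof (induction k)
  case (Suc k)
  then show ?case
    by (auto simp: two_row_def)
qed simp

lemma psize_two_row: "psize (two_row u v) = u + v"
  using psize_eq_sum[of 2 "two_row u v"] by (simp add: sum_two_row)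

lemma two_row_dominated:
  assumes "v \<le> u" "v' \<le> u'" "u + v = u' + v'" "u < u'"
  shows "two_row u v \<lhd> two_row u' v'"
proof -
  have "two_row u v \<noteq> two_row u' v'"
    using assms(4) by (metis two_row_simps(1) less_irrefl)
  then show ?thesis
    using assms by (auto simp: dominated_def two_row_partitions psize_two_row sum_two_row)
qed

lemma dominates_two_row:
  assumes "two_row u v \<lhd> p"
  shows "p = two_row (p 0) (p 1)" "p 0 + p 1 = u + v"
proof -
  have p: "p \<in> partitions" and size: "psize p = u + v"
    and le: "\<And>k. (\<Sum>i<k. two_row u v i) \<le> (\<Sum>i<k. p i)"
    using assms by (auto simp: dominated_def psize_two_row)
  obtain n where n: "\<And>i. n \<le> i \<Longrightarrow> p i = 0"
    using partitions_eventually_zero[OF p] by blast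
  have "u + v \<le> p 0 + p 1"
    using le[of 2] by (simp add: sum_two_row numeral_2_eq_2)
  moreover have "psize p = (\<Sum>i<n + 3. p i)"
    by (rule psize_eq_sum) (simp add: n)
  moreover have "p 0 + p 1 + p 2 \<le> (\<Sum>i<n + 3. p i)"
    using sum_mono2[of "{..<n + 3}" "{0, 1, 2}" p] by simp
  ultimately have "p 2 = 0" and sum: "p 0 + p 1 = u + v"
    using size by auto
  then have "\<And>i. 2 \<le> i \<Longrightarrow> p i = 0"
    using partitions_zero[OF p] by blast
  then show "p = two_row (p 0) (p 1)"
    by (auto simp: two_row_def)
  show "p 0 + p 1 = u + v"
    by (rule sum)
qed

lemma one_line_partitions: "one_line a \<in> partitions"
  by (rule partitionsI[where n = 1]) (auto simp: one_line_def)

lemma part_of_set_singleton: "part_of_set {a} = one_line a"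
  by (auto simp: part_of_set_def one_line_def)

lemma betas_two_row: "betas 2 (two_row u v) = {u + 1, v}"
  by (auto simp: betas_def numeral_2_eq_2 lessThan_Suc)

lemma two_row_quotient:
  assumes le: "v \<le> u" and halves: "odd_half {u + 1, v} = {a}" "even_half {u + 1, v} = {b}"
  shows "two_row u v \<in> empty_core_partitions" "two_quotient (two_row u v) = (one_line a, one_line b)"
proof -
  note p = two_row_partitions[OF le]
  have b: "betas (2 * 1) (two_row u v) = {u + 1, v}"
    using betas_two_row by simp
  have z: "two_row u v (2 * 1) = 0"
    by simp
  show "two_row u v \<in> empty_core_partitions"
    using charge_zero_iff_balanced[OF p z] p unfolding b by (simp add: halves[simplified] empty_core_iff_charge)
  show "two_quotient (two_row u v) = (one_line a, one_line b)"
    using two_quotient_eq[OF p z] unfolding quotient_at_eq b halves by (simp add: part_of_set_singleton)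
qed

lemma two_row_quotient_even:
  assumes "b \<le> a"
  shows "two_row (2 * a) (2 * b) \<in> empty_core_partitions"
    "two_quotient (two_row (2 * a) (2 * b)) = (one_line a, one_line b)"
proof -
  have "odd_half {2 * a + 1, 2 * b} = {a}" "even_half {2 * a + 1, 2 * b} = {b}"
    unfolding odd_half_def even_half_def by (auto; presburger)+
  then show "two_row (2 * a) (2 * b) \<in> empty_core_partitions"
    "two_quotient (two_row (2 * a) (2 * b)) = (one_line a, one_line b)"
    using two_row_quotient[of "2 * b" "2 * a"] assms by auto
qed

lemma two_row_quotient_odd:
  assumes "a < b"
  shows "two_row (2 * b - 1) (2 * a + 1) \<in> empty_core_partitions"
    "two_quotient (two_row (2 * b - 1) (2 * a + 1)) = (one_line a, one_line b)"
proof -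
  have "2 * b - 1 + 1 = 2 * b"
    using assms by simp
  then have "odd_half {2 * b - 1 + 1, 2 * a + 1} = {a}" "even_half {2 * b - 1 + 1, 2 * a + 1} = {b}"
    unfolding odd_half_def even_half_def by (auto; presburger)+
  then show "two_row (2 * b - 1) (2 * a + 1) \<in> empty_core_partitions"
    "two_quotient (two_row (2 * b - 1) (2 * a + 1)) = (one_line a, one_line b)"
    using two_row_quotient[of "2 * a + 1" "2 * b - 1"] assms by auto
qed

lemma two_quotient_inv_one_line:
  "two_quotient_inv (one_line a, one_line b) =
    (if b \<le> a then two_row (2 * a) (2 * b) else two_row (2 * b - 1) (2 * a + 1))"
  unfolding two_quotient_inv_def
  using two_row_quotient_even[of b a] two_row_quotient_odd[of a b]
  by (auto intro!: inv_into_f_eq[OF two_quotient_inj])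

lemma two_quotient_inv_one_line_obtain:
  obtains u v where "two_quotient_inv (one_line a, one_line b) = two_row u v"
    "v \<le> u" "u + v = 2 * (a + b)"
    "int u \<le> int (a + b) + \<bar>int a - int b\<bar>" "int (a + b) + \<bar>int a - int b\<bar> \<le> int u + 1"
proof (cases "b \<le> a")
  case True
  then show thesis
    using that[of "2 * a" "2 * b"] by (simp add: two_quotient_inv_one_line)
next
  case False
  then show thesis
    using that[of "2 * b - 1" "2 * a + 1"] by (simp add: two_quotient_inv_one_line)
qed

lemma two_quotient_two_row:
  assumes "v \<le> u" "u + v = 2 * n"
  shows "two_quotient (two_row u v) \<in> Bip1 n"
proof (cases "even u")
  case True
  then obtain a b where "u = 2 * a" "v = 2 * b"
    using assms(2) by (metis dvd_add_right_iff dvd_triv_left evenE)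
  then show ?thesis
    using assms two_row_quotient_even(2)[of b a] by (force simp: Bip1_def)
next
  case False
  then have "odd v"
    using assms(2) by presburger
  then obtain a c where ac: "v = 2 * a + 1" "u = 2 * c + 1"
    using False by (elim oddE)
  define b where "b = c + 1"
  have uv: "u = 2 * b - 1" "v = 2 * a + 1" "a < b" "a + b = n"
    using assms ac by (auto simp: b_def)
  have "two_quotient (two_row u v) = (one_line a, one_line b)"
    using two_row_quotient_odd(2)[OF uv(3)] uv(1,2) by simp
  then show ?thesis
    using uv(4) by (auto simp: Bip1_def)
qed

lemma Bip1_subset_Bip: "Bip1 n \<subseteq> Bip"
  by (auto simp: Bip1_def Bip_def Bip_deg_def one_line_partitions)

lemma Bip1_coideal: "coideal_in Bip (\<prec>) (Bip1 n)"
  unfolding coideal_in_def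
proof (intro conjI ballI impI)
  show "Bip1 n \<subseteq> Bip"
    by (rule Bip1_subset_Bip)
next
  fix \<beta> \<beta>'
  assume "\<beta> \<in> Bip1 n" and \<beta>': "\<beta>' \<in> Bip" and prec: "\<beta> \<prec> \<beta>'"
  then obtain a b where ab: "\<beta> = (one_line a, one_line b)" "a + b = n"
    by (auto simp: Bip1_def)
  obtain u v where uv: "two_quotient_inv \<beta> = two_row u v" "u + v = 2 * n"
    using two_quotient_inv_one_line_obtain[of a b] ab by metis
  let ?p = "two_quotient_inv \<beta>'"
  have dom: "two_row u v \<lhd> ?p"
    using prec uv(1) by (simp add: bip_prec_def)
  have "?p 1 \<le> ?p 0"
    using dom partitions_antimono[of ?p 0 1] by (simp add: dominated_def)
  then have "two_quotient (two_row (?p 0) (?p 1)) \<in> Bip1 n"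
    using dominates_two_row(2)[OF dom] uv(2) by (intro two_quotient_two_row) auto
  then show "\<beta>' \<in> Bip1 n"
    using dominates_two_row(1)[OF dom] two_quotient_inv_props(2)[OF \<beta>'] by simp
qed

lemma inj_on_wt: "inj_on wt (Bip1 n)"
proof (rule inj_onI)
  fix x y
  assume "x \<in> Bip1 n" "y \<in> Bip1 n" "wt x = wt y"
  then show "x = y"
    by (auto simp: Bip1_def wt_def one_line_def)
qed

lemma Lam_cases:
  assumes "l \<in> Lam n"
  obtains a b where "a + b = n" "l = int a - int b"
    "inv_into (Bip1 n) wt l = (one_line a, one_line b)"
proof -
  obtain k where k: "l = - int n + 2 * int k" "k \<le> n"
    using assms by (auto simp: Lam_def)
  then have "l = int k - int (n - k)"
    by (simp add: of_nat_diff)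
  moreover have "inv_into (Bip1 n) wt l = (one_line k, one_line (n - k))"
    using k by (intro inv_into_f_eq[OF inj_on_wt]) (force simp: Bip1_def, auto simp: wt_def one_line_def)
  ultimately show thesis
    using that[of k "n - k"] k(2) by simp
qed

lemma lam_prec_refines: "refines_on (Lam n) (lam_prec n) (conversep qh_less)"
  unfolding refines_on_def
proof (intro ballI impI)
  fix l m
  assume l: "l \<in> Lam n" and m: "m \<in> Lam n" and "conversep qh_less l m"
  then have less: "\<bar>l\<bar> < \<bar>m\<bar>"
    by (simp add: qh_less_def)
  obtain a b where ab: "a + b = n" "l = int a - int b"
    "inv_into (Bip1 n) wt l = (one_line a, one_line b)"
    using Lam_cases[OF l] .
  obtain c d where cd: "c + d = n" "m = int c - int d"
    "inv_into (Bip1 n) wt m = (one_line c, one_line d)"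
    using Lam_cases[OF m] .
  obtain u v where uv: "two_quotient_inv (one_line a, one_line b) = two_row u v" "v \<le> u"
    "u + v = 2 * (a + b)" "int u \<le> int (a + b) + \<bar>int a - int b\<bar>"
    using two_quotient_inv_one_line_obtain[of a b] by metis
  obtain x y where xy: "two_quotient_inv (one_line c, one_line d) = two_row x y" "y \<le> x"
    "x + y = 2 * (c + d)" "int (c + d) + \<bar>int c - int d\<bar> \<le> int x + 1"
    using two_quotient_inv_one_line_obtain[of c d] by metis
  \<comment> \<open>All elements of \<open>Lam n\<close> have the same parity; the gap of 2 absorbs the \<open>-1\<close> in the odd case.\<close>
  have "int a + int b = int c + int d"
    using ab(1) cd(1) by (metis of_nat_add)
  then have "m - l = 2 * (int c - int a)"
    using ab(2) cd(2) by simp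
  then have "even (m - l)"
    by simp
  then have "\<bar>l\<bar> + 2 \<le> \<bar>m\<bar>"
    using less by presburger
  then have "u < x"
    using uv(4) xy(4) ab(1,2) cd(1,2) by simp
  then have "two_row u v \<lhd> two_row x y"
    using uv(2,3) xy(2,3) ab(1) cd(1) by (intro two_row_dominated) auto
  then show "lam_prec n l m"
    by (simp add: lam_prec_def bip_prec_def ab(3) cd(3) uv(1) xy(1))
qed

theorem theorem2p11:
  fixes n :: nat
  shows "coideal_in Bip (\<prec>) (Bip1 n) \<and> refines_on (Lam n) (lam_prec n) (conversep qh_less)"
  using Bip1_coideal lam_prec_refines by blast

end
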